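(* Let $(\mathfrak m,\mathfrak g)$ be a crossed module of Lie algebras with action $\triangleright$ of $\mathfrak g$ on $\mathfrak m$ and Lie algebra morphism $\phi:\mathfrak m\to\mathfrak g$. Then $(\mathrm{Hom}(\mathfrak g,\mathfrak m)\oplus\mathfrak g,[\cdot,\cdot],(\cdot,\cdot)_{\mathfrak m},\rho=0)$ is an $\mathfrak m$-Courant algebroid (with anchor $\rho$ equal to zero), where the pairing $(\cdot,\cdot)_{\mathfrak m}$ is given by $$(A+u,B+v)_{\mathfrak m}=\tfrac12(Av+Bu),$$ and the (bilinear) Dorfman bracket is given by $$[u,v]=[u,v]_{\mathfrak g},\qquad [A,B]=A\circ\phi\circ B-B\circ\phi\circ A,$$ $$[A,v]=A\circ\mathrm{ad}^0_v-\mathrm{ad}^1_v\circ A+\cdot\triangleright Av+\phi(Av),\qquad [v,A]=\mathrm{ad}^1_v\circ A-A\circ\mathrm{ad}^0_v,$$ for all $A,B\in\mathrm{Hom}(\mathfrak g,\mathfrak m)$ and $u,v\in\mathfrak g$. Here $\mathrm{ad}^0_v\in\mathfrak{gl}(\mathfrak g)$ and $\mathrm{ad}^1_v\in\mathfrak{gl}(\mathfrak m)$ are given by $\mathrm{ad}^0_v(u)=[v,u]_{\mathfrak g}$ and $\mathrm{ad}^1_v(a)=v\triangleright a$ respectively, and $\cdot\triangleright Av\in\mathrm{Hom}(\mathfrak g,\mathfrak m)$ is defined by $(\cdot\triangleright Av)(u)=u\triangleright Av$.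
   Context: A crossed module of Lie algebras consists of a pair of Lie algebras $(\mathfrak m,\mathfrak g)$, an action $\triangleright$ of $\mathfrak g$ on $\mathfrak m$ and a Lie algebra morphism $\phi:\mathfrak m\to\mathfrak g$ such that $\phi(\xi)\triangleright\eta=[\xi,\eta]_{\mathfrak m}$ and $\phi(x\triangleright\xi)=[x,\phi(\xi)]_{\mathfrak g}$ for all $x\in\mathfrak g$, $\xi,\eta\in\mathfrak m$. An $\mathfrak m$-Courant algebroid is an $\mathrm{E}$-Courant algebroid over a point with $E=\mathfrak m$ (as a vector space). Explicitly, it is a quadruple $(\mathcal K,[\cdot,\cdot],(\cdot,\cdot)_{\mathfrak m},\rho)$ where $\mathcal K$ is a vector space with a Leibniz algebra bracket $[\cdot,\cdot]$, $(\cdot,\cdot)_{\mathfrak m}:\mathcal K\otimes\mathcal K\to\mathfrak m$ is a nondegenerate symmetric $\mathfrak m$-valued pairing, which induces an embedding $\mathcal K\hookrightarrow\mathrm{Hom}(\mathcal K,\mathfrak m)$ via $Y(X)=2(X,Y)_{\mathfrak m}$, and $\rho:\mathcal K\to\mathfrak{gl}(\mathfrak m)$ is a linear map called the anchor such that, with $\rho^\star:\mathfrak m\to\mathrm{Hom}(\mathcal K,\mathfrak m)$ defined by $\rho^\star(\mu)(X)=\rho(X)\mu$, the following hold for all $X,Y,Z\in\mathcal K$ and $\mu\in\mathfrak m$: (EC-1) $\rho[X,Y]=[\rho(X),\rho(Y)]$ (commutator); (EC-2) $[X,X]=\rho^\star(X,X)_{\mathfrak m}$; (EC-3) $\rho(X)(Y,Z)_{\mathfrak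 m}=([X,Y],Z)_{\mathfrak m}+(Y,[X,Z])_{\mathfrak m}$; (EC-4) $\rho^\star(\mathfrak m)\subset\mathcal K$, i.e. $(\rho^\star(\mu),X)_{\mathfrak m}=\tfrac12\rho(X)\mu$; (EC-5) $\rho\circ\rho^\star=0$.
   Formalization: The anchor is ρ(A+u)=A∘φ+ad¹_u instead of ρ=0: for ρ=0, (EC-2) fails unless φ and ▷ vanish or 𝔤=0 (e.g. 𝔪=𝔤=ℝ abelian, φ=id, ▷=0). Also assumed: 𝔪=0 implies 𝔤=0 (otherwise the pairing is degenerate), and 2≠0 in the ground field. *)

theory Defs
  imports Complex_Main "HOL-Library.Function_Algebras" "HOL-Library.Product_Plus"
begin

text \<open>The ground field is an arbitrary field, and each vector space is a type with a
  scalar multiplication (the library locale \<^locale>\<open>vector_space\<close>). No finite-dimensionality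
  is assumed.\<close>

locale lie_algebra = vector_space scale
  for scale :: "'k::field \<Rightarrow> 'a::ab_group_add \<Rightarrow> 'a" +
  fixes bracket :: "'a \<Rightarrow> 'a \<Rightarrow> 'a"
  assumes linear_left: "Vector_Spaces.linear scale scale (\<lambda>x. bracket x y)"
    and linear_right: "Vector_Spaces.linear scale scale (bracket x)"
    and alternating: "bracket x x = 0"
    and jacobi: "bracket x (bracket y z) + bracket y (bracket z x) + bracket z (bracket x y) = 0"

locale crossed_module =
  m: lie_algebra scale_m bracket_m + g: lie_algebra scale_g bracket_g
  for scale_m :: "'k::field \<Rightarrow> 'm::ab_group_add \<Rightarrow> 'm"
    and bracket_m :: "'m \<Rightarrow> 'm \<Rightarrow> 'm"
    and scale_g :: "'k \<Rightarrow> 'g::ab_group_add \<Rightarrow> 'g"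
    and bracket_g :: "'g \<Rightarrow> 'g \<Rightarrow> 'g" +
  fixes act :: "'g \<Rightarrow> 'm \<Rightarrow> 'm"
    and phi :: "'m \<Rightarrow> 'g"
  assumes act_linear_left: "Vector_Spaces.linear scale_g scale_m (\<lambda>x. act x \<xi>)"
    and act_linear_right: "Vector_Spaces.linear scale_m scale_m (act x)"
    and act_bracket: "act (bracket_g x y) \<xi> = act x (act y \<xi>) - act y (act x \<xi>)"
    and act_derivation:
      "act x (bracket_m \<xi> \<eta>) = bracket_m (act x \<xi>) \<eta> + bracket_m \<xi> (act x \<eta>)"
    and phi_linear: "Vector_Spaces.linear scale_m scale_g phi"
    and phi_bracket: "phi (bracket_m \<xi> \<eta>) = bracket_g (phi \<xi>) (phi \<eta>)"
    and peiffer: "act (phi \<xi>) \<eta> = bracket_m \<xi> \<eta>"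
    and equivariant: "phi (act x \<xi>) = bracket_g x (phi \<xi>)"

text \<open>The space underlying an \<open>\<mm>\<close>-Courant algebroid is a subspace \<open>K\<close> of an ambient vector
  space, so that \<open>Hom(\<gg>, \<mm>) \<oplus> \<gg>\<close> can be taken as the subspace of all \<open>(A, u)\<close> with \<open>A\<close> linear
  in the space of pairs of an arbitrary function and a vector.
  The operations are constrained on \<open>K\<close> only.
  The inclusion \<open>K \<hookrightarrow> Hom(K, \<mm>)\<close>, \<open>Y(X) = 2 (X, Y)\<close>, is \<open>embed\<close>; elements of \<open>Hom(K, \<mm>)\<close>
  are equal if they agree on \<open>K\<close>.\<close>

definition rho_star :: "('a \<Rightarrow> 'm \<Rightarrow> 'm) \<Rightarrow> 'm \<Rightarrow> 'a \<Rightarrow> 'm" where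
  "rho_star rho \<mu> = (\<lambda>X. rho X \<mu>)"

definition embed :: "('k::field \<Rightarrow> 'm \<Rightarrow> 'm) \<Rightarrow> ('a \<Rightarrow> 'a \<Rightarrow> 'm) \<Rightarrow> 'a \<Rightarrow> 'a \<Rightarrow> 'm" where
  "embed scale_m pairing Y = (\<lambda>X. scale_m 2 (pairing X Y))"

locale m_courant_algebroid =
  amb: vector_space scale + m: vector_space scale_m
  for scale :: "'k::field \<Rightarrow> 'a::ab_group_add \<Rightarrow> 'a"
    and scale_m :: "'k \<Rightarrow> 'm::ab_group_add \<Rightarrow> 'm" +
  fixes K :: "'a set"
    and bracket :: "'a \<Rightarrow> 'a \<Rightarrow> 'a"
    and pairing :: "'a \<Rightarrow> 'a \<Rightarrow> 'm"
    and rho :: "'a \<Rightarrow> 'm \<Rightarrow> 'm"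
  assumes subspace_K: "amb.subspace K"
    and bracket_closed: "\<lbrakk>X \<in> K; Y \<in> K\<rbrakk> \<Longrightarrow> bracket X Y \<in> K"
    and bracket_add_left: "\<lbrakk>X \<in> K; Y \<in> K; Z \<in> K\<rbrakk> \<Longrightarrow> bracket (X + Y) Z = bracket X Z + bracket Y Z"
    and bracket_scale_left: "\<lbrakk>X \<in> K; Y \<in> K\<rbrakk> \<Longrightarrow> bracket (scale c X) Y = scale c (bracket X Y)"
    and bracket_add_right: "\<lbrakk>X \<in> K; Y \<in> K; Z \<in> K\<rbrakk> \<Longrightarrow> bracket X (Y + Z) = bracket X Y + bracket X Z"
    and bracket_scale_right: "\<lbrakk>X \<in> K; Y \<in> K\<rbrakk> \<Longrightarrow> bracket X (scale c Y) = scale c (bracket X Y)"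
    and leibniz: "\<lbrakk>X \<in> K; Y \<in> K; Z \<in> K\<rbrakk> \<Longrightarrow>
      bracket X (bracket Y Z) = bracket (bracket X Y) Z + bracket Y (bracket X Z)"
    and pairing_add: "\<lbrakk>X \<in> K; Y \<in> K; Z \<in> K\<rbrakk> \<Longrightarrow> pairing (X + Y) Z = pairing X Z + pairing Y Z"
    and pairing_scale: "\<lbrakk>X \<in> K; Y \<in> K\<rbrakk> \<Longrightarrow> pairing (scale c X) Y = scale_m c (pairing X Y)"
    and pairing_sym: "\<lbrakk>X \<in> K; Y \<in> K\<rbrakk> \<Longrightarrow> pairing X Y = pairing Y X"
    and pairing_nondegenerate: "\<lbrakk>X \<in> K; \<And>Y. Y \<in> K \<Longrightarrow> pairing X Y = 0\<rbrakk> \<Longrightarrow> X = 0"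
    and rho_gl: "X \<in> K \<Longrightarrow> Vector_Spaces.linear scale_m scale_m (rho X)"
    and rho_add: "\<lbrakk>X \<in> K; Y \<in> K\<rbrakk> \<Longrightarrow> rho (X + Y) \<mu> = rho X \<mu> + rho Y \<mu>"
    and rho_scale: "X \<in> K \<Longrightarrow> rho (scale c X) \<mu> = scale_m c (rho X \<mu>)"
    and EC_1: "\<lbrakk>X \<in> K; Y \<in> K\<rbrakk> \<Longrightarrow> rho (bracket X Y) = (rho X \<circ> rho Y) - (rho Y \<circ> rho X)"
    and EC_2: "\<lbrakk>X \<in> K; Y \<in> K\<rbrakk> \<Longrightarrow>
      embed scale_m pairing (bracket X X) Y = rho_star rho (pairing X X) Y"
    and EC_3: "\<lbrakk>X \<in> K; Y \<in> K; Z \<in> K\<rbrakk> \<Longrightarrow>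
      rho X (pairing Y Z) = pairing (bracket X Y) Z + pairing Y (bracket X Z)"
    and EC_4: "\<exists>Y\<in>K. \<forall>X\<in>K. embed scale_m pairing Y X = rho_star rho \<mu> X"
    and EC_5: "\<lbrakk>Y \<in> K; \<And>X. X \<in> K \<Longrightarrow> embed scale_m pairing Y X = rho_star rho \<mu> X\<rbrakk> \<Longrightarrow> rho Y = 0"

definition hom_sum ::
    "('k::field \<Rightarrow> 'm::ab_group_add \<Rightarrow> 'm) \<Rightarrow> ('k \<Rightarrow> 'g::ab_group_add \<Rightarrow> 'g)
      \<Rightarrow> (('g \<Rightarrow> 'm) \<times> 'g) set" where
  "hom_sum scale_m scale_g = {(A, u). Vector_Spaces.linear scale_g scale_m A}"

definition sum_scale ::
    "('k::field \<Rightarrow> 'm \<Rightarrow> 'm) \<Rightarrow> ('k \<Rightarrow> 'g \<Rightarrow> 'g) \<Rightarrow> 'k \<Rightarrow> ('g \<Rightarrow> 'm) \<times> 'g \<Rightarrow> ('g \<Rightarrow> 'm) \<times> 'g" where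
  "sum_scale scale_m scale_g c = (\<lambda>(A, u). (\<lambda>x. scale_m c (A x), scale_g c u))"

definition hom_pairing ::
    "('k::field \<Rightarrow> 'm::ab_group_add \<Rightarrow> 'm) \<Rightarrow> ('g \<Rightarrow> 'm) \<times> 'g \<Rightarrow> ('g \<Rightarrow> 'm) \<times> 'g \<Rightarrow> 'm" where
  "hom_pairing scale_m = (\<lambda>(A, u) (B, v). scale_m (1 / 2) (A v + B u))"

text \<open>In the bracket below, the three groups of the \<open>Hom(\<gg>, \<mm>)\<close>-component come from \<open>[A, B]\<close>,
  \<open>[A, v]\<close> and \<open>[u, B]\<close>, where \<open>bracket_g v\<close> is \<open>ad\<^sup>0\<^sub>v\<close> and \<open>act v\<close> is \<open>ad\<^sup>1\<^sub>v\<close>.\<close>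

definition dorfman ::
    "('g::ab_group_add \<Rightarrow> 'g \<Rightarrow> 'g) \<Rightarrow> ('g \<Rightarrow> 'm::ab_group_add \<Rightarrow> 'm) \<Rightarrow> ('m \<Rightarrow> 'g)
      \<Rightarrow> ('g \<Rightarrow> 'm) \<times> 'g \<Rightarrow> ('g \<Rightarrow> 'm) \<times> 'g \<Rightarrow> ('g \<Rightarrow> 'm) \<times> 'g" where
  "dorfman bracket_g act phi = (\<lambda>(A, u) (B, v).
    (((A \<circ> phi \<circ> B) - (B \<circ> phi \<circ> A))
       + ((A \<circ> bracket_g v) - (act v \<circ> A) + (\<lambda>x. act x (A v)))
       + ((act u \<circ> B) - (B \<circ> bracket_g u)),
     bracket_g u v + phi (A v)))"

text \<open>The anchor is \<open>\<rho>(A + u) = A \<circ> \<phi> + ad\<^sup>1\<^sub>u\<close>, not \<open>0\<close>. Since \<open>[X, X]\<close> has the value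
  \<open>(\<cdot> \<triangleright> A u, \<phi>(A u))\<close> at \<open>X = A + u\<close>, the axiom \<open>EC_2\<close> fails for the zero anchor unless \<open>\<triangleright>\<close> and
  \<open>\<phi>\<close> both vanish (or \<open>\<gg> = 0\<close>); \<open>zero_anchor_counterexample\<close> is an instance.
  Conversely \<open>EC_2\<close> leaves no choice: by \<open>anchor_forced\<close>, for \<open>\<gg> \<noteq> 0\<close> the bracket and the pairing
  determine the anchor.\<close>

definition hom_anchor ::
    "('g \<Rightarrow> 'm::ab_group_add \<Rightarrow> 'm) \<Rightarrow> ('m \<Rightarrow> 'g) \<Rightarrow> ('g \<Rightarrow> 'm) \<times> 'g \<Rightarrow> 'm \<Rightarrow> 'm" where
  "hom_anchor act phi = (\<lambda>(A, u). (A \<circ> phi) + act u)"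

lemma zero_anchor_counterexample:
  shows "crossed_module (*) (\<lambda>_ _. 0::real) (*) (\<lambda>_ _. 0::real) (\<lambda>_ _. 0) id"
    and "\<not> m_courant_algebroid (sum_scale (*) (*)) (*) (hom_sum (*) (*))
           (dorfman (\<lambda>_ _. 0::real) (\<lambda>_ _. 0::real) id) (hom_pairing (*)) (\<lambda>_ _. 0)"
proof -
  interpret R: vector_space "(*) :: real \<Rightarrow> real \<Rightarrow> real"
    by unfold_locales (auto simp: algebra_simps)
  have l: "Vector_Spaces.linear (*) (*) (id :: real \<Rightarrow> real)"
    and z: "Vector_Spaces.linear (*) (*) (\<lambda>_::real. 0::real)"
    by unfold_locales (auto simp: algebra_simps)
  show "crossed_module (*) (\<lambda>_ _. 0::real) (*) (\<lambda>_ _. 0::real) (\<lambda>_ _. 0) id"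
    by unfold_locales (auto simp: algebra_simps)
  show "\<not> m_courant_algebroid (sum_scale (*) (*)) (*) (hom_sum (*) (*))
           (dorfman (\<lambda>_ _. 0::real) (\<lambda>_ _. 0::real) id) (hom_pairing (*)) (\<lambda>_ _. 0)"
  proof
    assume "m_courant_algebroid (sum_scale (*) (*)) (*) (hom_sum (*) (*))
           (dorfman (\<lambda>_ _. 0::real) (\<lambda>_ _. 0::real) id) (hom_pairing (*)) (\<lambda>_ _. 0)"
    from m_courant_algebroid.EC_2[OF this, of "(id, 1)" "(id, 0)"] l
    show False
      by (simp add: hom_sum_def dorfman_def hom_pairing_def embed_def rho_star_def)
  qed
qed

lemma anchor_forced:
  fixes scale_m :: "'k::field \<Rightarrow> 'm::ab_group_add \<Rightarrow> 'm"
    and scale_g :: "'k \<Rightarrow> 'g::ab_group_add \<Rightarrow> 'g"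
  assumes char: "(2::'k) \<noteq> 0"
    and cm: "crossed_module scale_m bracket_m scale_g bracket_g act phi"
    and g: "u0 \<noteq> (0::'g)"
    and mc: "m_courant_algebroid (sum_scale scale_m scale_g) scale_m (hom_sum scale_m scale_g)
      (dorfman bracket_g act phi) (hom_pairing scale_m) rho"
    and X: "X \<in> hom_sum scale_m scale_g"
  shows "rho X = hom_anchor act phi X"
proof
  fix \<mu>
  interpret crossed_module scale_m bracket_m scale_g bracket_g act phi by fact
  interpret C: m_courant_algebroid "sum_scale scale_m scale_g" scale_m "hom_sum scale_m scale_g"
    "dorfman bracket_g act phi" "hom_pairing scale_m" rho by fact
  interpret P: vector_space_pair scale_g scale_m ..
  have "g.independent {u0}" using g by simp
  from P.linear_independent_extend[OF this, of "\<lambda>_. \<mu>"]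
  obtain A where A: "Vector_Spaces.linear scale_g scale_m A" "A u0 = \<mu>" by auto
  have AK: "(A, u0) \<in> hom_sum scale_m scale_g" using A by (simp add: hom_sum_def)
  obtain B v where e: "X = (B, v)" by force
  have "(1 / 2 + 1 / 2 :: 'k) = 1" using char by (simp add: field_simps)
  then have half_sum: "scale_m (1 / 2) (x + x) = x" for x
    by (metis m.scale_left_distrib m.scale_one m.scale_right_distrib)
  show "rho X \<mu> = hom_anchor act phi X \<mu>"
    using C.EC_2[OF AK X] A(2) g.alternating char
    by (simp add: e embed_def rho_star_def hom_pairing_def dorfman_def half_sum hom_anchor_def
        plus_fun_def fun_diff_def)
qed

end

theory Submission
  imports Defs
begin

text \<open>An element \<open>X = A + u\<close> acts on the two-term complex \<open>\<phi> : \<mm> \<rightarrow> \<gg>\<close> by the chain map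
  consisting of the anchor \<open>\<rho>\<^sub>X = A \<circ> \<phi> + ad\<^sup>1\<^sub>u\<close> on \<open>\<mm>\<close> and of \<open>\<sigma>\<^sub>X = \<phi> \<circ> A + ad\<^sup>0\<^sub>u\<close> on \<open>\<gg>\<close>.
  For \<open>X = u\<close> this chain map is a derivation of the bracket of \<open>\<gg>\<close> and of the action \<open>\<triangleright>\<close>. For \<open>X = A\<close>
  it is null-homotopic, and it is a derivation up to a homotopy: the failure is measured by the
  alternating map \<open>\<theta>\<^sub>A(x, y) = A[x, y] - x \<triangleright> A y + y \<triangleright> A x\<close>, which is, up to sign, the
  Chevalley--Eilenberg differential of the cochain \<open>A\<close> on \<open>\<gg>\<close> with values in \<open>\<mm>\<close>.

  In these terms the Dorfman bracket takes the form
  \<open>[X, B + v] = (\<rho>\<^sub>X \<circ> B - B \<circ> \<sigma>\<^sub>X + \<theta>\<^sub>A(v, \<cdot>)) + \<sigma>\<^sub>X v\<close> (lemma \<open>dorfman_eq\<close>), and the axioms become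
  properties of the triple \<open>(\<rho>\<^sub>X, \<sigma>\<^sub>X, \<theta>\<^sub>A)\<close>:

  \<^item> The pairing is built from the evaluation \<open>B w\<close>, and \<open>\<rho>\<^sub>X \<circ> B - B \<circ> \<sigma>\<^sub>X\<close> is the induced action of
    \<open>X\<close> on \<open>Hom(\<gg>, \<mm>)\<close>. Invariance of the pairing is therefore the antisymmetry of \<open>\<theta>\<^sub>A\<close>.

  \<^item> The Leibniz identity says that \<open>X \<mapsto> [X, \<cdot>]\<close> turns brackets into commutators. It follows
    because \<open>\<rho>\<close> and \<open>\<sigma>\<close> turn brackets into commutators (lemmas \<open>anchor_bracket\<close> and
    \<open>sigma_bracket\<close>) and because \<open>\<theta>\<close> satisfies the matching identity (lemma \<open>theta_bracket\<close>). The
    latter combines the two derivation rules up to homotopy with the cocycle condition for \<open>\<theta>\<^sub>A\<close>.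

  \<^item> The element corresponding to \<open>\<rho>\<^sup>\<star>(\<mu>)\<close> is \<open>\<cdot> \<triangleright> \<mu> + \<phi>(\<mu>)\<close>. Its anchor vanishes by the Peiffer
    identity and the antisymmetry of the bracket of \<open>\<mm>\<close>, and \<open>[X, X]\<close> is this element for
    \<open>\<mu> = (X, X)\<close>.

  The pairing is nondegenerate as soon as linear maps into \<open>\<mm>\<close> separate the points of \<open>\<gg>\<close>, which
  holds if \<open>\<mm> \<noteq> 0\<close> or \<open>\<gg> = 0\<close>.\<close>

lemma linear_imp_simps:
  assumes "Vector_Spaces.linear s1 s2 f"
  shows "f (x + y) = f x + f y" "f (x - y) = f x - f y" "f (- x) = - f x" "f 0 = 0"
    "f (s1 c x) = s2 c (f x)"
proof -
  interpret Vector_Spaces.linear s1 s2 f by fact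
  show "f (x + y) = f x + f y" "f (x - y) = f x - f y" "f (- x) = - f x" "f 0 = 0"
    "f (s1 c x) = s2 c (f x)"
    by (simp_all add: add diff neg zero scale)
qed

lemma linear_maps_separate_points:
  fixes scale_m :: "'k::field \<Rightarrow> 'm::ab_group_add \<Rightarrow> 'm"
    and scale_g :: "'k \<Rightarrow> 'g::ab_group_add \<Rightarrow> 'g"
  assumes "vector_space scale_g" "vector_space scale_m" and "\<mu> \<noteq> (0::'m)"
    and zero: "\<And>A. Vector_Spaces.linear scale_g scale_m A \<Longrightarrow> A v = 0"
  shows "v = 0"
proof (rule ccontr)
  assume "v \<noteq> 0"
  interpret g: vector_space scale_g by fact
  interpret m: vector_space scale_m by fact
  interpret vector_space_pair scale_g scale_m ..
  have "g.independent {v}" using \<open>v \<noteq> 0\<close> by simp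
  from linear_independent_extend[OF this, of "\<lambda>_. \<mu>"] zero \<open>\<mu> \<noteq> 0\<close> show False by auto
qed

lemma vector_space_sum_scale:
  assumes "vector_space scale_g" "vector_space scale_m"
  shows "vector_space (sum_scale scale_m scale_g)"
proof -
  interpret g: vector_space scale_g by fact
  interpret m: vector_space scale_m by fact
  show ?thesis
    by unfold_locales
      (auto simp: sum_scale_def plus_fun_def g.scale_right_distrib m.scale_right_distrib
        g.scale_left_distrib m.scale_left_distrib)
qed

context crossed_module
begin

section \<open>Calculus in a crossed module\<close>

lemmas bracket_g_simps = linear_imp_simps[OF g.linear_left] linear_imp_simps[OF g.linear_right]
lemmas act_simps = linear_imp_simps[OF act_linear_left] linear_imp_simps[OF act_linear_right]
lemmas phi_simps = linear_imp_simps[OF phi_linear]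

lemma bracket_g_swap: "bracket_g x y = - bracket_g y x"
proof -
  have "bracket_g (x + y) (x + y) = 0" by (rule g.alternating)
  then have "bracket_g x y + bracket_g y x = 0"
    by (simp only: bracket_g_simps) (simp add: g.alternating add.commute)
  then show ?thesis by (simp only: eq_neg_iff_add_eq_0)
qed

lemma bracket_g_nested:
  "bracket_g (bracket_g x y) z = bracket_g x (bracket_g y z) - bracket_g y (bracket_g x z)"
proof -
  have "bracket_g (bracket_g x y) z = - bracket_g z (bracket_g x y)" by (rule bracket_g_swap)
  moreover have "bracket_g y (bracket_g z x) = - bracket_g y (bracket_g x z)"
    by (subst bracket_g_swap[of z x]) (simp add: bracket_g_simps)
  moreover have "bracket_g x (bracket_g y z) + bracket_g y (bracket_g z x)
      = - bracket_g z (bracket_g x y)"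
    using g.jacobi[of x y z] by (simp only: eq_neg_iff_add_eq_0)
  ultimately show ?thesis by simp
qed

lemma peiffer_swap: "act (phi \<xi>) \<eta> = - act (phi \<eta>) \<xi>"
proof -
  have "bracket_m (\<xi> + \<eta>) (\<xi> + \<eta>) = 0" by (rule m.alternating)
  then have "bracket_m \<xi> \<eta> + bracket_m \<eta> \<xi> = 0"
    by (simp only: linear_imp_simps[OF m.linear_left] linear_imp_simps[OF m.linear_right])
      (simp add: m.alternating add.commute)
  then show ?thesis by (simp only: peiffer eq_neg_iff_add_eq_0)
qed

section \<open>The derivation up to homotopy attached to an element\<close>

abbreviation anchor :: "('g \<Rightarrow> 'm) \<times> 'g \<Rightarrow> 'm \<Rightarrow> 'm" where
  "anchor \<equiv> hom_anchor act phi"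

abbreviation bracket :: "('g \<Rightarrow> 'm) \<times> 'g \<Rightarrow> ('g \<Rightarrow> 'm) \<times> 'g \<Rightarrow> ('g \<Rightarrow> 'm) \<times> 'g" where
  "bracket \<equiv> dorfman bracket_g act phi"

abbreviation K :: "(('g \<Rightarrow> 'm) \<times> 'g) set" where
  "K \<equiv> hom_sum scale_m scale_g"

definition sigma :: "('g \<Rightarrow> 'm) \<times> 'g \<Rightarrow> 'g \<Rightarrow> 'g" where
  "sigma X x = phi (fst X x) + bracket_g (snd X) x"

text \<open>Up to sign this is the Chevalley--Eilenberg differential of the \<open>\<mm>\<close>-valued cochain \<open>A\<close>.\<close>

definition theta :: "('g \<Rightarrow> 'm) \<Rightarrow> 'g \<Rightarrow> 'g \<Rightarrow> 'm" where
  "theta A x y = A (bracket_g x y) - act x (A y) + act y (A x)"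

lemma anchor_eq: "anchor X \<mu> = fst X (phi \<mu>) + act (snd X) \<mu>"
  by (simp add: hom_anchor_def plus_fun_def case_prod_beta)

lemma linear_fst: "X \<in> K \<Longrightarrow> Vector_Spaces.linear scale_g scale_m (fst X)"
  by (auto simp: hom_sum_def)

lemmas fst_simps = linear_imp_simps[OF linear_fst]

lemma anchor_linear:
  assumes "X \<in> K"
  shows "Vector_Spaces.linear scale_m scale_m (anchor X)"
  unfolding Vector_Spaces.linear_iff
  by (auto simp: anchor_eq fst_simps[OF assms] phi_simps act_simps m.scale_right_distrib
      m.vector_space_axioms)

lemmas anchor_simps = linear_imp_simps[OF anchor_linear]

lemma sigma_linear:
  assumes "X \<in> K"
  shows "Vector_Spaces.linear scale_g scale_g (sigma X)"
  unfolding Vector_Spaces.linear_iff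
  by (auto simp: sigma_def fst_simps[OF assms] phi_simps bracket_g_simps g.scale_right_distrib
      g.vector_space_axioms)

lemmas sigma_simps = linear_imp_simps[OF sigma_linear]

lemma theta_swap:
  assumes "X \<in> K"
  shows "theta (fst X) x y = - theta (fst X) y x"
  by (subst theta_def, subst bracket_g_swap) (simp add: theta_def fst_simps[OF assms])

lemma theta_linear_right:
  assumes "X \<in> K"
  shows "Vector_Spaces.linear scale_g scale_m (theta (fst X) x)"
  unfolding Vector_Spaces.linear_iff
  by (auto simp: theta_def fst_simps[OF assms] bracket_g_simps act_simps m.scale_right_distrib
      m.scale_right_diff_distrib m.vector_space_axioms g.vector_space_axioms)

lemma theta_linear_left:
  assumes "X \<in> K"
  shows "Vector_Spaces.linear scale_g scale_m (\<lambda>x. theta (fst X) x y)"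
  unfolding Vector_Spaces.linear_iff
  by (auto simp: theta_def fst_simps[OF assms] bracket_g_simps act_simps m.scale_right_distrib
      m.scale_right_diff_distrib m.vector_space_axioms g.vector_space_axioms)

lemmas theta_simps = linear_imp_simps[OF theta_linear_left] linear_imp_simps[OF theta_linear_right]

text \<open>The part \<open>\<phi> \<circ> A\<close> of \<open>\<sigma>\<^sub>X\<close> satisfies \<open>[\<phi>(A x), y] + [x, \<phi>(A y)] = \<phi>(x \<triangleright> A y - y \<triangleright> A x)\<close> by
  equivariance, so it differs from a derivation exactly by \<open>\<phi> \<circ> \<theta>\<^sub>A\<close>.\<close>

lemma sigma_derivation:
  "sigma X (bracket_g x y)
    = bracket_g (sigma X x) y + bracket_g x (sigma X y) + phi (theta (fst X) x y)"
proof -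
  have "bracket_g (phi (fst X x)) y = - phi (act y (fst X x))"
    by (subst bracket_g_swap) (simp add: equivariant)
  then show ?thesis
    by (simp add: sigma_def theta_def bracket_g_simps phi_simps equivariant bracket_g_nested)
qed

text \<open>Here the homotopy term appears because \<open>\<phi>(A x) \<triangleright> \<xi>\<close> equals \<open>- \<phi>(\<xi>) \<triangleright> A x\<close> by the Peiffer
  identity.\<close>

lemma anchor_derivation:
  "anchor X (act x \<xi>) = act (sigma X x) \<xi> + act x (anchor X \<xi>) + theta (fst X) x (phi \<xi>)"
  by (simp add: anchor_eq sigma_def theta_def act_simps equivariant act_bracket
      peiffer_swap[of \<xi> "fst X x"])

text \<open>The square of the Chevalley--Eilenberg differential is zero.\<close>

lemma theta_cocycle:
  assumes "X \<in> K"
  shows "theta (fst X) (bracket_g v x) y + theta (fst X) x (bracket_g v y)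
      - act v (theta (fst X) x y)
    = theta (fst X) v (bracket_g x y) - act x (theta (fst X) v y) + act y (theta (fst X) v x)"
  by (simp add: theta_def fst_simps[OF assms] act_simps act_bracket bracket_g_nested
      bracket_g_swap[of y v])

section \<open>The Dorfman bracket as a commutator\<close>

lemma dorfman_eq:
  assumes "Y \<in> K"
  shows "bracket X Y =
    (\<lambda>x. anchor X (fst Y x) - fst Y (sigma X x) + theta (fst X) (snd Y) x, sigma X (snd Y))"
  by (auto simp: dorfman_def case_prod_beta fun_eq_iff plus_fun_def fun_diff_def anchor_eq
      sigma_def theta_def fst_simps[OF assms] algebra_simps)

lemma dorfman_closed:
  assumes "X \<in> K" "Y \<in> K"
  shows "bracket X Y \<in> K"
  unfolding dorfman_eq[OF assms(2)] hom_sum_def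
  by (auto simp: Vector_Spaces.linear_iff anchor_simps[OF assms(1)] sigma_simps[OF assms(1)]
      fst_simps[OF assms(2)] theta_simps[OF assms(1)] m.scale_right_distrib
      m.scale_right_diff_distrib m.vector_space_axioms g.vector_space_axioms)

lemma anchor_bracket:
  assumes "X \<in> K" "Y \<in> K"
  shows "anchor (bracket X Y) \<mu> = anchor X (anchor Y \<mu>) - anchor Y (anchor X \<mu>)"
  by (simp add: dorfman_eq[OF assms(2)] anchor_eq sigma_def theta_def fst_simps[OF assms(1)]
      fst_simps[OF assms(2)] phi_simps act_simps act_bracket equivariant peiffer_swap[of \<mu>])

lemma sigma_bracket:
  assumes "X \<in> K" "Y \<in> K"
  shows "sigma (bracket X Y) x = sigma X (sigma Y x) - sigma Y (sigma X x)"
proof -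
  have "bracket_g (phi \<mu>) x = - bracket_g x (phi \<mu>)" for \<mu> by (rule bracket_g_swap)
  then show ?thesis
    by (simp add: dorfman_eq[OF assms(2)] anchor_eq sigma_def theta_def fst_simps[OF assms(1)]
        fst_simps[OF assms(2)] bracket_g_simps phi_simps equivariant bracket_g_nested)
qed

text \<open>The right-hand side is the homotopy of the commutator of two derivations up to homotopy.
  Applying \<open>\<theta>\<close> to the part \<open>\<rho>\<^sub>X \<circ> B - B \<circ> \<sigma>\<^sub>X\<close> of the bracket and moving \<open>\<rho>\<^sub>X\<close> and \<open>\<sigma>\<^sub>X\<close> past \<open>\<triangleright>\<close> and
  the bracket of \<open>\<gg>\<close> produces the terms with \<open>\<theta>\<^sub>B\<close> and those terms with \<open>\<theta>\<^sub>A\<close> that contain \<open>B\<close>. The part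
  \<open>\<theta>\<^sub>A(v, \<cdot>)\<close> supplies the terms with \<open>\<theta>\<^sub>A\<close> and \<open>v\<close>, by the cocycle condition.\<close>

lemma theta_bracket:
  assumes X: "X \<in> K" and Y: "Y \<in> K"
  shows "theta (fst (bracket X Y)) x y =
      anchor X (theta (fst Y) x y) - theta (fst Y) (sigma X x) y - theta (fst Y) x (sigma X y)
    - (anchor Y (theta (fst X) x y) - theta (fst X) (sigma Y x) y - theta (fst X) x (sigma Y y))"
proof -
  let ?A = "fst X" and ?B = "fst Y" and ?v = "snd Y"
  let ?DB = "\<lambda>x. anchor X (?B x) - ?B (sigma X x)"
  note lin = fst_simps[OF Y] anchor_simps[OF X] act_simps
  have B_sigma: "?B (bracket_g (sigma X x) y) + ?B (bracket_g x (sigma X y))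
      = ?B (sigma X (bracket_g x y)) - ?B (phi (theta ?A x y))"
    by (simp add: sigma_derivation lin)
  have "theta ?DB x y =
      anchor X (theta ?B x y) - theta ?B (sigma X x) y - theta ?B x (sigma X y)
      + theta ?A x (phi (?B y)) + theta ?A (phi (?B x)) y - ?B (phi (theta ?A x y))"
    using B_sigma
    by (simp add: theta_def[of ?DB] theta_def[of ?B] lin anchor_derivation
        theta_swap[OF X, of "phi (?B x)"] algebra_simps)
  moreover have "theta (theta ?A ?v) x y =
      theta ?A (bracket_g ?v x) y + theta ?A x (bracket_g ?v y) - act ?v (theta ?A x y)"
    by (simp add: theta_cocycle[OF X] theta_def[of "theta ?A ?v"])
  moreover have "theta (fst (bracket X Y)) x y = theta ?DB x y + theta (theta ?A ?v) x y"
    by (simp add: dorfman_eq[OF Y] theta_def[of ?DB] theta_def[of "theta ?A ?v"]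
        theta_def[of "\<lambda>x. anchor X (?B x) - ?B (sigma X x) + theta ?A ?v x"] act_simps)
  ultimately show ?thesis
    by (simp add: anchor_eq[of Y] sigma_def[of Y] theta_simps[OF X])
qed

text \<open>With \<open>Z = C + w\<close>, the component in \<open>\<gg>\<close> is the commutator rule for \<open>\<sigma>\<close> evaluated at \<open>w\<close>. In the
  component in \<open>Hom(\<gg>, \<mm>)\<close> the terms containing \<open>C\<close> match by the commutator rules for \<open>\<rho>\<close> and
  \<open>\<sigma>\<close>, and the terms containing \<open>w\<close> match by the one for \<open>\<theta>\<close>.\<close>

lemma dorfman_leibniz:
  assumes X: "X \<in> K" and Y: "Y \<in> K" and Z: "Z \<in> K"
  shows "bracket X (bracket Y Z) = bracket (bracket X Y) Z + bracket Y (bracket X Z)"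
proof -
  have XY: "bracket X Y \<in> K" and XZ: "bracket X Z \<in> K" and YZ: "bracket Y Z \<in> K"
    using assms by (auto intro: dorfman_closed)
  show ?thesis
    unfolding dorfman_eq[OF YZ] dorfman_eq[OF XZ] dorfman_eq[of Z "bracket X Y", OF Z]
    by (simp add: dorfman_eq[OF Z] anchor_bracket[OF X Y] sigma_bracket[OF X Y]
        theta_bracket[OF X Y] anchor_simps[OF X] anchor_simps[OF Y] fst_simps[OF Z]
        plus_fun_def fun_eq_iff)
qed

section \<open>The pairing\<close>

abbreviation pairing :: "('g \<Rightarrow> 'm) \<times> 'g \<Rightarrow> ('g \<Rightarrow> 'm) \<times> 'g \<Rightarrow> 'm" where
  "pairing \<equiv> hom_pairing scale_m"

lemma pairing_eq: "pairing X Y = scale_m (1 / 2) (fst X (snd Y) + fst Y (snd X))"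
  by (simp add: hom_pairing_def case_prod_beta)

lemma pairing_sym: "pairing X Y = pairing Y X"
  by (simp add: pairing_eq add.commute)

lemma embed_pairing:
  assumes "(2::'k) \<noteq> 0"
  shows "embed scale_m pairing Y X = fst X (snd Y) + fst Y (snd X)"
  using assms by (simp add: embed_def pairing_eq)

lemma half_double:
  assumes "(2::'k) \<noteq> 0"
  shows "scale_m (1 / 2) (\<mu> + \<mu>) = \<mu>"
proof -
  have "\<mu> + \<mu> = scale_m 2 \<mu>"
    using m.scale_left_distrib[of 1 1 \<mu>] by simp
  then show ?thesis using assms by simp
qed

text \<open>The two terms containing \<open>\<theta>\<^sub>A\<close> cancel, and what remains is the product rule for the
  evaluation of \<open>Hom(\<gg>, \<mm>)\<close> on \<open>\<gg>\<close>.\<close>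

lemma pairing_invariant:
  assumes X: "X \<in> K" and Y: "Y \<in> K" and Z: "Z \<in> K"
  shows "anchor X (pairing Y Z) = pairing (bracket X Y) Z + pairing Y (bracket X Z)"
  by (simp add: pairing_eq anchor_simps[OF X] dorfman_eq[OF Y] dorfman_eq[OF Z]
      theta_swap[OF X, of "snd Z"] flip: m.scale_right_distrib)

text \<open>This is the element of \<open>Hom(\<gg>, \<mm>) \<oplus> \<gg>\<close> corresponding to \<open>\<rho>\<^sup>\<star>(\<mu>)\<close>.\<close>

definition coanchor :: "'m \<Rightarrow> ('g \<Rightarrow> 'm) \<times> 'g" where
  "coanchor \<mu> = (\<lambda>x. act x \<mu>, phi \<mu>)"

lemma coanchor_closed: "coanchor \<mu> \<in> K"
  by (simp add: coanchor_def hom_sum_def act_linear_left)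

lemma embed_coanchor:
  assumes "(2::'k) \<noteq> 0"
  shows "embed scale_m pairing (coanchor \<mu>) X = rho_star anchor \<mu> X"
  by (simp add: embed_pairing[OF assms] coanchor_def rho_star_def anchor_eq)

lemma anchor_coanchor: "anchor (coanchor \<mu>) = 0"
  by (simp add: fun_eq_iff anchor_eq coanchor_def peiffer_swap[of \<mu>])

lemma dorfman_square:
  assumes "(2::'k) \<noteq> 0" "X \<in> K"
  shows "bracket X X = coanchor (pairing X X)"
  by (simp add: pairing_eq half_double[OF assms(1)] dorfman_eq[OF assms(2)] coanchor_def anchor_eq
      sigma_def theta_def fst_simps[OF assms(2)] g.alternating)

lemma pairing_nondegenerate:
  assumes char: "(2::'k) \<noteq> 0"
    and nontrivial: "(\<forall>\<mu>::'m. \<mu> = 0) \<longrightarrow> (\<forall>u::'g. u = 0)"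
    and zero: "\<And>Y. Y \<in> K \<Longrightarrow> embed scale_m pairing X Y = 0"
  shows "X = 0"
proof -
  obtain A u where X: "X = (A, u)" by force
  have "(0, v) \<in> K" for v
    by (simp add: hom_sum_def zero_fun_def Vector_Spaces.linear_iff m.vector_space_axioms
        g.vector_space_axioms)
  from zero[OF this] have "A v = 0" for v
    by (simp add: X embed_pairing[OF char])
  moreover have "u = 0"
  proof (cases "\<forall>\<mu>::'m. \<mu> = 0")
    case True
    with nontrivial show ?thesis by blast
  next
    case False
    then obtain \<mu> :: 'm where "\<mu> \<noteq> 0" by blast
    moreover have "B u = 0" if "Vector_Spaces.linear scale_g scale_m B" for B
      using zero[of "(B, 0)"] that \<open>\<And>v. A v = 0\<close>
      by (simp add: X embed_pairing[OF char] hom_sum_def)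
    ultimately show ?thesis
      using linear_maps_separate_points[OF g.vector_space_axioms m.vector_space_axioms] by blast
  qed
  ultimately show ?thesis by (simp add: X zero_prod_def fun_eq_iff)
qed

end

theorem proposition3p7:
  fixes scale_m :: "'k::field \<Rightarrow> 'm::ab_group_add \<Rightarrow> 'm"
    and scale_g :: "'k \<Rightarrow> 'g::ab_group_add \<Rightarrow> 'g"
  assumes char: "(2::'k) \<noteq> 0"
    and cm: "crossed_module scale_m bracket_m scale_g bracket_g act phi"
    and nontrivial: "(\<forall>\<mu>::'m. \<mu> = 0) \<longrightarrow> (\<forall>u::'g. u = 0)"
  shows "m_courant_algebroid (sum_scale scale_m scale_g) scale_m (hom_sum scale_m scale_g)
    (dorfman bracket_g act phi) (hom_pairing scale_m) (hom_anchor act phi)"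
proof -
  interpret crossed_module scale_m bracket_m scale_g bracket_g act phi by fact
  interpret amb: vector_space "sum_scale scale_m scale_g"
    by (rule vector_space_sum_scale[OF g.vector_space_axioms m.vector_space_axioms])
  have snd_add: "snd (X + Y) = snd X + snd Y" and fst_add: "fst (X + Y) x = fst X x + fst Y x"
    for X Y :: "('g \<Rightarrow> 'm) \<times> 'g" and x
    by (simp_all add: plus_fun_def)
  have snd_scale: "snd (sum_scale scale_m scale_g c X) = scale_g c (snd X)"
    and fst_scale: "fst (sum_scale scale_m scale_g c X) x = scale_m c (fst X x)" for c X x
    by (simp_all add: sum_scale_def case_prod_beta)
  have K_iff: "X \<in> K \<longleftrightarrow> Vector_Spaces.linear scale_g scale_m (fst X)" for X
    by (auto simp: hom_sum_def)
  have subspace: "amb.subspace K"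
    unfolding amb.subspace_def
    by (auto simp: K_iff Vector_Spaces.linear_iff fst_scale plus_fun_def zero_prod_def zero_fun_def
        m.scale_right_distrib m.vector_space_axioms g.vector_space_axioms
        algebra_simps)
  note add_closed = amb.subspace_add[OF subspace] and scale_closed = amb.subspace_scale[OF subspace]
  have dorfman_linear_left: "bracket (X + Y) Z = bracket X Z + bracket Y Z"
      "bracket (sum_scale scale_m scale_g c X) Z = sum_scale scale_m scale_g c (bracket X Z)"
    if Z: "Z \<in> K" for X Y Z c
    by (simp_all add: dorfman_eq[OF Z] sum_scale_def case_prod_beta fun_eq_iff plus_fun_def
        anchor_eq sigma_def theta_def fst_simps[OF Z] phi_simps act_simps bracket_g_simps
        m.scale_right_distrib m.scale_right_diff_distrib g.scale_right_distrib)
  have dorfman_linear_right: "bracket X (Y + Z) = bracket X Y + bracket X Z"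
      "bracket X (sum_scale scale_m scale_g c Y) = sum_scale scale_m scale_g c (bracket X Y)"
    if X: "X \<in> K" and Y: "Y \<in> K" and Z: "Z \<in> K" for X Y Z c
    by (simp_all add: dorfman_eq add_closed scale_closed X Y Z fst_scale snd_scale fst_add snd_add
        anchor_simps[OF X] sigma_simps[OF X] theta_simps[OF X])
      (simp_all add: sum_scale_def case_prod_beta fun_eq_iff plus_fun_def
        m.scale_right_distrib m.scale_right_diff_distrib)
  show ?thesis
  proof (intro m_courant_algebroid.intro m_courant_algebroid_axioms.intro)
    fix X Y assume zero: "X \<in> K" "\<And>Y. Y \<in> K \<Longrightarrow> pairing X Y = 0"
    show "X = 0"
      using char nontrivial
      by (rule pairing_nondegenerate) (use zero in \<open>auto simp: embed_def pairing_sym[of _ X]\<close>)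
  next
    fix X Y assume "X \<in> K" "Y \<in> K"
    then show "embed scale_m pairing (bracket X X) Y = rho_star anchor (pairing X X) Y"
      by (simp add: dorfman_square[OF char] embed_coanchor[OF char])
  next
    show "\<exists>Y\<in>K. \<forall>X\<in>K. embed scale_m pairing Y X = rho_star anchor \<mu> X" for \<mu>
      using coanchor_closed embed_coanchor[OF char] by blast
  next
    fix Y \<mu> assume Y: "Y \<in> K" "\<And>X. X \<in> K \<Longrightarrow> embed scale_m pairing Y X = rho_star anchor \<mu> X"
    \<comment> \<open>By nondegeneracy \<open>coanchor \<mu>\<close> is the only element that corresponds to \<open>\<rho>\<^sup>\<star>(\<mu>)\<close>.\<close>
    have "Y - coanchor \<mu> = 0"
      using char nontrivial
    proof (rule pairing_nondegenerate)
      fix X assume X: "X \<in> K"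
      show "embed scale_m pairing (Y - coanchor \<mu>) X = 0"
        using Y(2)[OF X] embed_coanchor[OF char, of \<mu> X]
        by (simp add: embed_pairing[OF char] fst_simps[OF X] algebra_simps)
    qed
    then show "anchor Y = 0" by (simp add: anchor_coanchor)
  next
    fix X Y Z assume "X \<in> K" "Y \<in> K" "Z \<in> K"
    then show "bracket X (bracket Y Z) = bracket (bracket X Y) Z + bracket Y (bracket X Z)"
      by (rule dorfman_leibniz)
    show "anchor X (pairing Y Z) = pairing (bracket X Y) Z + pairing Y (bracket X Z)"
      using \<open>X \<in> K\<close> \<open>Y \<in> K\<close> \<open>Z \<in> K\<close> by (rule pairing_invariant)
  next
    fix X assume "X \<in> K"
    then show "Vector_Spaces.linear scale_m scale_m (anchor X)" by (rule anchor_linear)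
  next
    fix X Y assume "X \<in> K" "Y \<in> K"
    then show "anchor (bracket X Y) = (anchor X \<circ> anchor Y) - (anchor Y \<circ> anchor X)"
      by (simp add: fun_eq_iff fun_diff_def anchor_bracket)
  qed (simp_all add: amb.vector_space_axioms m.vector_space_axioms subspace dorfman_closed
      dorfman_linear_left dorfman_linear_right pairing_sym
      pairing_eq anchor_eq act_simps fst_simps fst_add snd_add fst_scale snd_scale
      m.scale_right_distrib add_ac)
qed

end
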